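(* Let $(X,R)$ be an infinite ultrahomogeneous cyclically ordered set with the discrete topology, let $G=(\mathrm{Aut}(X,R),\tau_\partial)$ be its automorphism group with the permutation topology, and let $i_X:G\to 2^{X\times X}$, $i_X(g)=\{(x,gx):x\in X\}$, where $2^{X\times X}$ carries the Fell topology. The set $b_XG:=\overline{i_X(G)}$ is algebraically isomorphic to the semigroup $\mathrm{pAut}(X,R)$ of all partial automorphisms of $(X,R)$ (a partial automorphism being identified with its graph in $X\times X$). Moreover, $b_XG$ is a semitopological semigroup with a continuous involution $s:A\mapsto sA$.
   Context: Cyclic orders. A cyclically ordered (c.o.) set $(X,R)$, $|X|\ge 3$, is a set with a ternary relation $R=[\cdot,\cdot,\cdot]$ satisfying: cyclicity $[a,b,c]\Rightarrow[b,c,a]$; asymmetry $[a,b,c]\Rightarrow\neg[b,a,c]$; transitivity $[a,b,c]\wedge[a,c,d]\Rightarrow[a,b,d]$; completeness: for pairwise distinct $a,b,c$ either $[a,b,c]$ or $[a,c,b]$. A tuple $(x_1,\dots,x_n)$, $n\ge3$, is a cycle if $[x_i,x_j,x_k]$ for all $i<j<k$; a tuple of length 1 is a cycle; a pair $(x_1,x_2)$ is a cycle if $x_1\ne x_2$. $\mathrm{Aut}(X,R)$ is the group of bijections $f:X\to X$ with $[a,b,c]\iff[fa,fb,fc]$. $(X,R)$ is ultrahomogeneous if for every $n\in\mathbb N$ and any cycles $(x_1,\dots,x_n)$, $(y_1,\dots,y_n)$ in $X$ there is $g\in \mathrm{Aut}(X,R)$ with $gx_i=y_i$ for all $i$. A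 partial automorphism of $(X,R)$ is a bijection $p:A\to B$ between subsets $A,B\subset X$ (possibly empty or of cardinality less than 3) with $[a,b,c]\iff[pa,pb,pc]$ for all $a,b,c\in A$. The set $\mathrm{pAut}(X,R)$ of all partial automorphisms is an inverse semigroup under composition of partial maps, which corresponds to composition of relations $BA=\{(x,z): \exists y\ (x,y)\in A,\ (y,z)\in B\}$ on graphs. For $A\subset X\times X$, $sA=\{(y,x):(x,y)\in A\}$. The permutation topology $\tau_\partial$ is the topology of pointwise convergence for the action on the discrete space $X$ (pointwise stabilizers of finite subsets form a base at the identity). $2^{X\times X}$ is the set of all closed subsets of the discrete space $X\times X$ (i.e. all subsets, including $\varnothing$). The Fell topology on it has as base the sets $\{F: F\cap V_i\neq\varnothing\ (i\le n),\ F\cap K_j=\varnothing\ (j\le m)\}$ with $V_i$ open and $K_j$ compact (here: finite). A semitopological semigroup is a semigroup with a topology in which multiplication is separately continuous. *)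

theory Defs
  imports "HOL-Analysis.Analysis" "HOL-Algebra.Group"
begin

definition cyclically_ordered :: "'a set \<Rightarrow> ('a \<Rightarrow> 'a \<Rightarrow> 'a \<Rightarrow> bool) \<Rightarrow> bool" where
  "cyclically_ordered X R \<longleftrightarrow>
     (infinite X \<or> 3 \<le> card X) \<and>
     (\<forall>a\<in>X. \<forall>b\<in>X. \<forall>c\<in>X. R a b c \<longrightarrow> R b c a) \<and>
     (\<forall>a\<in>X. \<forall>b\<in>X. \<forall>c\<in>X. R a b c \<longrightarrow> \<not> R b a c) \<and>
     (\<forall>a\<in>X. \<forall>b\<in>X. \<forall>c\<in>X. \<forall>d\<in>X. R a b c \<and> R a c d \<longrightarrow> R a b d) \<and>
     (\<forall>a\<in>X. \<forall>b\<in>X. \<forall>c\<in>X. a \<noteq> b \<and> b \<noteq> c \<and> a \<noteq> c \<longrightarrow> R a b c \<or> R a c b)"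

definition is_cycle :: "'a set \<Rightarrow> ('a \<Rightarrow> 'a \<Rightarrow> 'a \<Rightarrow> bool) \<Rightarrow> 'a list \<Rightarrow> bool" where
  "is_cycle X R xs \<longleftrightarrow> set xs \<subseteq> X \<and>
     (length xs = 1 \<or>
      length xs = 2 \<and> xs ! 0 \<noteq> xs ! 1 \<or>
      3 \<le> length xs \<and>
        (\<forall>i j k. i < j \<and> j < k \<and> k < length xs \<longrightarrow> R (xs ! i) (xs ! j) (xs ! k)))"

text \<open>Automorphisms are taken extensional on \<open>X\<close>, so that equality of HOL functions is
  equality of maps on \<open>X\<close>.\<close>

definition cyc_Aut :: "'a set \<Rightarrow> ('a \<Rightarrow> 'a \<Rightarrow> 'a \<Rightarrow> bool) \<Rightarrow> ('a \<Rightarrow> 'a) set" where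
  "cyc_Aut X R = {f \<in> extensional X. bij_betw f X X \<and>
     (\<forall>a\<in>X. \<forall>b\<in>X. \<forall>c\<in>X. R a b c \<longleftrightarrow> R (f a) (f b) (f c))}"

definition ultrahomogeneous :: "'a set \<Rightarrow> ('a \<Rightarrow> 'a \<Rightarrow> 'a \<Rightarrow> bool) \<Rightarrow> bool" where
  "ultrahomogeneous X R \<longleftrightarrow>
     (\<forall>xs ys. is_cycle X R xs \<and> is_cycle X R ys \<and> length xs = length ys \<longrightarrow>
        (\<exists>g\<in>cyc_Aut X R. \<forall>i<length xs. g (xs ! i) = ys ! i))"

definition cyc_pAut :: "'a set \<Rightarrow> ('a \<Rightarrow> 'a \<Rightarrow> 'a \<Rightarrow> bool) \<Rightarrow> ('a \<rightharpoonup> 'a) set" where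
  "cyc_pAut X R = {p. dom p \<subseteq> X \<and> ran p \<subseteq> X \<and> inj_on p (dom p) \<and>
     (\<forall>a\<in>dom p. \<forall>b\<in>dom p. \<forall>c\<in>dom p.
        R a b c \<longleftrightarrow> R (the (p a)) (the (p b)) (the (p c)))}"

text \<open>Both semigroups below happen to have an identity, which fills the field \<open>one\<close> of the
  record; homomorphisms and isomorphisms (\<open>hom\<close>, \<open>iso\<close>) refer to carrier and
  multiplication only.\<close>

definition pAut_semigroup :: "'a set \<Rightarrow> ('a \<Rightarrow> 'a \<Rightarrow> 'a \<Rightarrow> bool) \<Rightarrow> ('a \<rightharpoonup> 'a) monoid" where
  "pAut_semigroup X R =
     \<lparr>carrier = cyc_pAut X R, mult = (\<lambda>q p. q \<circ>\<^sub>m p), one = Some |` X\<rparr>"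

text \<open>\<open>rel_mult B A\<close> is the composition \<open>B \<circ> A\<close> (first \<open>A\<close>, then \<open>B\<close>); \<open>O\<close> composes in the
  opposite order.\<close>

definition rel_mult :: "('a \<times> 'a) set \<Rightarrow> ('a \<times> 'a) set \<Rightarrow> ('a \<times> 'a) set" where
  "rel_mult B A = A O B"

definition permutation_topology ::
    "'a set \<Rightarrow> ('a \<Rightarrow> 'a \<Rightarrow> 'a \<Rightarrow> bool) \<Rightarrow> ('a \<Rightarrow> 'a) topology" where
  "permutation_topology X R =
     subtopology (product_topology (\<lambda>_. discrete_topology X) X) (cyc_Aut X R)"

lemma topspace_permutation_topology [simp]:
  "topspace (permutation_topology X R) = cyc_Aut X R"
  by (auto simp: permutation_topology_def cyc_Aut_def bij_betw_def PiE_def)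

definition fell_base :: "'b topology \<Rightarrow> 'b set set set" where
  "fell_base T =
     {{F. closedin T F \<and> (\<forall>V\<in>\<V>. F \<inter> V \<noteq> {}) \<and> (\<forall>K\<in>\<K>. F \<inter> K = {})} | \<V> \<K>.
        finite \<V> \<and> (\<forall>V\<in>\<V>. openin T V) \<and> finite \<K> \<and> (\<forall>K\<in>\<K>. compactin T K)}"

definition fell_topology :: "'b topology \<Rightarrow> 'b set topology" where
  "fell_topology T = topology (arbitrary union_of (\<lambda>B. B \<in> fell_base T))"

lemma openin_fell_topology:
  "openin (fell_topology T) = (arbitrary union_of (\<lambda>B. B \<in> fell_base T))"
proof -
  have "A \<inter> B \<in> fell_base T" if A: "A \<in> fell_base T" and B: "B \<in> fell_base T" for A B
  proof -
    from A obtain V K where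
      1: "A = {F. closedin T F \<and> (\<forall>V\<in>V. F \<inter> V \<noteq> {}) \<and> (\<forall>K\<in>K. F \<inter> K = {})}"
         "finite V" "\<forall>V\<in>V. openin T V" "finite K" "\<forall>K\<in>K. compactin T K"
      unfolding fell_base_def by blast
    from B obtain V' K' where
      2: "B = {F. closedin T F \<and> (\<forall>V\<in>V'. F \<inter> V \<noteq> {}) \<and> (\<forall>K\<in>K'. F \<inter> K = {})}"
         "finite V'" "\<forall>V\<in>V'. openin T V" "finite K'" "\<forall>K\<in>K'. compactin T K"
      unfolding fell_base_def by blast
    have "A \<inter> B = {F. closedin T F \<and> (\<forall>V\<in>V \<union> V'. F \<inter> V \<noteq> {}) \<and> (\<forall>K\<in>K \<union> K'. F \<inter> K = {})}"
      unfolding 1(1) 2(1) by blast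
    moreover have "finite (V \<union> V')" "\<forall>W\<in>V \<union> V'. openin T W"
      "finite (K \<union> K')" "\<forall>L\<in>K \<union> K'. compactin T L"
      using 1 2 by auto
    ultimately show ?thesis unfolding fell_base_def by blast
  qed
  then have "istopology (arbitrary union_of (\<lambda>B. B \<in> fell_base T))"
    by (intro istopology_base) auto
  then show ?thesis unfolding fell_topology_def by (rule topology_inverse')
qed

lemma topspace_fell_topology [simp]: "topspace (fell_topology T) = {F. closedin T F}"
proof -
  have "{F. closedin T F} \<in> fell_base T"
    unfolding fell_base_def by (rule CollectI, rule exI[of _ "{}"], rule exI[of _ "{}"]) auto
  then have "openin (fell_topology T) {F. closedin T F}"
    unfolding openin_fell_topology by (rule arbitrary_union_of_inc)
  moreover have "U \<subseteq> {F. closedin T F}" if "openin (fell_topology T) U" for U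
    using that unfolding openin_fell_topology union_of_def fell_base_def by blast
  ultimately show ?thesis unfolding topspace_def by blast
qed

definition graph_on :: "'a set \<Rightarrow> ('a \<Rightarrow> 'a) \<Rightarrow> ('a \<times> 'a) set" where
  "graph_on X g = {(x, g x) | x. x \<in> X}"

definition bG :: "'a set \<Rightarrow> ('a \<Rightarrow> 'a \<Rightarrow> 'a \<Rightarrow> bool) \<Rightarrow> ('a \<times> 'a) set set" where
  "bG X R = fell_topology (discrete_topology (X \<times> X)) closure_of
              (graph_on X ` topspace (permutation_topology X R))"

definition bG_topology ::
    "'a set \<Rightarrow> ('a \<Rightarrow> 'a \<Rightarrow> 'a \<Rightarrow> bool) \<Rightarrow> ('a \<times> 'a) set topology" where
  "bG_topology X R = subtopology (fell_topology (discrete_topology (X \<times> X))) (bG X R)"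

definition bG_semigroup ::
    "'a set \<Rightarrow> ('a \<Rightarrow> 'a \<Rightarrow> 'a \<Rightarrow> bool) \<Rightarrow> ('a \<times> 'a) set monoid" where
  "bG_semigroup X R = \<lparr>carrier = bG X R, mult = rel_mult, one = Id_on X\<rparr>"

definition semitopological_semigroup :: "'b topology \<Rightarrow> ('b \<Rightarrow> 'b \<Rightarrow> 'b) \<Rightarrow> bool" where
  "semitopological_semigroup T m \<longleftrightarrow>
     (\<forall>x\<in>topspace T. \<forall>y\<in>topspace T. m x y \<in> topspace T) \<and>
     (\<forall>x\<in>topspace T. \<forall>y\<in>topspace T. \<forall>z\<in>topspace T. m (m x y) z = m x (m y z)) \<and>
     (\<forall>a\<in>topspace T. continuous_map T T (\<lambda>x. m a x) \<and> continuous_map T T (\<lambda>x. m x a))"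

text \<open>An involution of a semigroup is an anti-automorphism of order at most two.\<close>

definition continuous_involution :: "'b topology \<Rightarrow> ('b \<Rightarrow> 'b \<Rightarrow> 'b) \<Rightarrow> ('b \<Rightarrow> 'b) \<Rightarrow> bool" where
  "continuous_involution T m s \<longleftrightarrow>
     continuous_map T T s \<and>
     (\<forall>x\<in>topspace T. s (s x) = x) \<and>
     (\<forall>x\<in>topspace T. \<forall>y\<in>topspace T. s (m x y) = m (s y) (s x))"

end

theory Submission
  imports Defs
begin

text \<open>Over a discrete space \<open>Y\<close> the Fell topology only records, for finitely many points at a time,
  whether they belong to a set: it is the topology of pointwise convergence of indicator functions.
  So a relation lies in the closure of the graphs of automorphisms iff every finite piece of
  positive and negative information about it is shared by the graph of some automorphism.

  Being single valued, injective and compatible with \<open>R\<close> are conditions on at most three pairs each.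
  They therefore pass to limits, and every element of the closure is the graph of a partial
  automorphism (\<open>bG_subset_pAut_graphs\<close>).

  For the converse, let \<open>S\<close> be the graph of a partial automorphism, \<open>F \<subseteq> S\<close> finite, and \<open>K\<close> finite and
  disjoint from \<open>S\<close>. Restrict \<open>S\<close> to the finite set \<open>A\<close> of those points of its domain that
  occur as first coordinates in \<open>F\<close> or \<open>K\<close>. By ultrahomogeneity an automorphism \<open>g\<close> extends this
  restriction; it contains \<open>F\<close> and cannot meet \<open>K\<close> above \<open>A\<close>. It may still meet \<open>K\<close> above finitely
  many points outside \<open>A\<close>. These collisions are removed one point at a time by composing with
  automorphisms that fix everything settled so far, which is possible because the pointwise
  stabilizer of a finite set has infinite orbits outside that set
  (\<open>infinite_orbit_of_stabilizer\<close>). The reason is that the order is dense: all intervals are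
  infinite, and all points in the same gap of a finite set are conjugate over it.

  Once the closure is identified with the graphs of partial automorphisms, taking graphs is the
  required isomorphism. Multiplication by a fixed \<open>A\<close> is continuous because \<open>A\<close> is injective and
  single valued: membership of one pair in a product is decided by membership of at most one pair
  in the other factor. For general relations infinitely many intermediate points could matter, and
  already membership in a product would fail to be a closed condition.\<close>

section \<open>The Fell topology of a discrete space\<close>

text \<open>Compact subsets of a discrete space are finite, and a nonempty intersection with an open set is
  witnessed by a single point. So a basic neighbourhood of \<open>S\<close> shrinks to a cylinder, given
  by finitely many required points \<open>F\<close> and finitely many forbidden points \<open>K\<close>.\<close>

lemma openin_fell_discrete_iff:
  "openin (fell_topology (discrete_topology Y)) U \<longleftrightarrow>
     U \<subseteq> Pow Y \<and>
     (\<forall>S\<in>U. \<exists>F K. finite F \<and> finite K \<and> F \<subseteq> S \<and> S \<inter> K = {} \<and>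
        {T. T \<subseteq> Y \<and> F \<subseteq> T \<and> T \<inter> K = {}} \<subseteq> U)"
  (is "?open U \<longleftrightarrow> ?sub U \<and> ?cyl U")
proof
  assume U: "?open U"
  show "?sub U \<and> ?cyl U"
  proof (intro conjI ballI)
    show "U \<subseteq> Pow Y"
      using openin_subset[OF U] by auto
  next
    fix S assume "S \<in> U"
    then obtain B where B: "B \<in> fell_base (discrete_topology Y)" "S \<in> B" "B \<subseteq> U"
      using U unfolding openin_fell_topology arbitrary_union_of_alt by blast
    then obtain \<V> \<K> where
      Beq: "B = {F. F \<subseteq> Y \<and> (\<forall>V\<in>\<V>. F \<inter> V \<noteq> {}) \<and> (\<forall>K\<in>\<K>. F \<inter> K = {})}"
      and fin: "finite \<V>" "finite \<K>" and cpt: "\<forall>K\<in>\<K>. compactin (discrete_topology Y) K"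
      unfolding fell_base_def by auto
    have "\<forall>V\<in>\<V>. \<exists>e. e \<in> S \<inter> V"
      using B(2) Beq by blast
    then obtain h where h: "\<And>V. V \<in> \<V> \<Longrightarrow> h V \<in> S \<inter> V"
      by metis
    have hS: "h ` \<V> \<subseteq> S"
      using h by blast
    have "finite (\<Union>\<K>)"
      using fin(2) cpt by (auto simp: compactin_discrete_topology)
    moreover have "S \<inter> \<Union>\<K> = {}"
      using B(2) Beq by blast
    moreover have "{T. T \<subseteq> Y \<and> h ` \<V> \<subseteq> T \<and> T \<inter> \<Union>\<K> = {}} \<subseteq> B"
    proof clarify
      fix T assume T: "T \<subseteq> Y" "h ` \<V> \<subseteq> T" "T \<inter> \<Union>\<K> = {}"
      have "T \<inter> V \<noteq> {}" if "V \<in> \<V>" for V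
        using h[OF that] that T(2) by blast
      then show "T \<in> B"
        unfolding Beq using T by blast
    qed
    ultimately show "\<exists>F K. finite F \<and> finite K \<and> F \<subseteq> S \<and> S \<inter> K = {} \<and>
        {T. T \<subseteq> Y \<and> F \<subseteq> T \<and> T \<inter> K = {}} \<subseteq> U"
      using fin(1) subset_trans[OF _ B(3)] hS
      by (intro exI[of _ "h ` \<V>"] exI[of _ "\<Union>\<K>"]) simp
  qed
next
  assume U: "?sub U \<and> ?cyl U"
  show "?open U"
    unfolding openin_fell_topology arbitrary_union_of_alt
  proof
    fix S assume S: "S \<in> U"
    then obtain F K where FK: "finite F" "finite K" "F \<subseteq> S" "S \<inter> K = {}"
      "{T. T \<subseteq> Y \<and> F \<subseteq> T \<and> T \<inter> K = {}} \<subseteq> U"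
      using U by meson
    have SY: "S \<subseteq> Y"
      using U S by blast
    define \<V> where "\<V> = (\<lambda>e. {e}) ` F"
    define \<K> where "\<K> = {K \<inter> Y}"
    define B where
      "B = {T. closedin (discrete_topology Y) T \<and> (\<forall>V\<in>\<V>. T \<inter> V \<noteq> {}) \<and> (\<forall>L\<in>\<K>. T \<inter> L = {})}"
    have "\<forall>V\<in>\<V>. openin (discrete_topology Y) V"
      using FK SY by (auto simp: \<V>_def)
    moreover have "\<forall>L\<in>\<K>. compactin (discrete_topology Y) L"
      using FK by (auto simp: \<K>_def compactin_discrete_topology)
    ultimately have "B \<in> fell_base (discrete_topology Y)"
      using FK(1) unfolding fell_base_def B_def
      by (intro CollectI exI[of _ \<V>] exI[of _ \<K>]) (auto simp: \<V>_def \<K>_def)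
    moreover have "B = {T. T \<subseteq> Y \<and> F \<subseteq> T \<and> T \<inter> K = {}}"
      by (auto simp: B_def \<V>_def \<K>_def)
    ultimately show "\<exists>B. B \<in> fell_base (discrete_topology Y) \<and> S \<in> B \<and> B \<subseteq> U"
      using FK SY by blast
  qed
qed

lemma openin_fell_discrete_cylinder:
  assumes "finite F" "finite K"
  shows "openin (fell_topology (discrete_topology Y)) {T. T \<subseteq> Y \<and> F \<subseteq> T \<and> T \<inter> K = {}}"
  unfolding openin_fell_discrete_iff
proof (intro conjI ballI)
  fix S assume "S \<in> {T. T \<subseteq> Y \<and> F \<subseteq> T \<and> T \<inter> K = {}}"
  then show "\<exists>F' K'. finite F' \<and> finite K' \<and> F' \<subseteq> S \<and> S \<inter> K' = {} \<and>
      {T. T \<subseteq> Y \<and> F' \<subseteq> T \<and> T \<inter> K' = {}} \<subseteq> {T. T \<subseteq> Y \<and> F \<subseteq> T \<and> T \<inter> K = {}}"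
    using assms by (intro exI[of _ F] exI[of _ K]) simp
qed blast

lemma in_closure_of_fell_discrete:
  assumes "\<A> \<subseteq> Pow Y"
  shows "S \<in> fell_topology (discrete_topology Y) closure_of \<A> \<longleftrightarrow>
    S \<subseteq> Y \<and> (\<forall>F K. finite F \<and> finite K \<and> F \<subseteq> S \<and> S \<inter> K = {} \<longrightarrow>
      (\<exists>T\<in>\<A>. F \<subseteq> T \<and> T \<inter> K = {}))"
  (is "?cl \<longleftrightarrow> ?approx")
proof
  assume S: ?cl
  then have "S \<subseteq> Y"
    by (auto simp: in_closure_of)
  moreover have "\<exists>T\<in>\<A>. F \<subseteq> T \<and> T \<inter> K = {}"
    if FK: "finite F" "finite K" "F \<subseteq> S" "S \<inter> K = {}" for F K
  proof -
    let ?U = "{T. T \<subseteq> Y \<and> F \<subseteq> T \<and> T \<inter> K = {}}"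
    have "S \<in> ?U"
      using FK \<open>S \<subseteq> Y\<close> by simp
    then obtain T where "T \<in> \<A>" "T \<in> ?U"
      using S openin_fell_discrete_cylinder[OF FK(1,2), of Y] unfolding in_closure_of by meson
    then show ?thesis
      by auto
  qed
  ultimately show ?approx
    by blast
next
  assume S: ?approx
  have "\<exists>T. T \<in> \<A> \<and> T \<in> U"
    if U: "S \<in> U" "openin (fell_topology (discrete_topology Y)) U" for U
  proof -
    obtain F K where FK: "finite F" "finite K" "F \<subseteq> S" "S \<inter> K = {}"
      "{T. T \<subseteq> Y \<and> F \<subseteq> T \<and> T \<inter> K = {}} \<subseteq> U"
      using U unfolding openin_fell_discrete_iff by meson
    then obtain T where "T \<in> \<A>" "F \<subseteq> T" "T \<inter> K = {}"
      using S by meson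
    then show ?thesis
      using FK(5) assms by blast
  qed
  then show ?cl
    using S by (auto simp: in_closure_of)
qed

lemma continuous_map_into_fell_discrete:
  assumes sub: "\<And>t. t \<in> topspace T \<Longrightarrow> f t \<subseteq> Y"
    and pos: "\<And>e. e \<in> Y \<Longrightarrow> openin T {t \<in> topspace T. e \<in> f t}"
    and neg: "\<And>e. e \<in> Y \<Longrightarrow> openin T {t \<in> topspace T. e \<notin> f t}"
  shows "continuous_map T (fell_topology (discrete_topology Y)) f"
  unfolding continuous_map_def
proof (intro conjI allI impI)
  show "f \<in> topspace T \<rightarrow> topspace (fell_topology (discrete_topology Y))"
    using sub by auto
next
  fix U assume U: "openin (fell_topology (discrete_topology Y)) U"
  show "openin T {t \<in> topspace T. f t \<in> U}"
  proof (subst openin_subopen, clarify)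
    fix t assume t: "t \<in> topspace T" "f t \<in> U"
    then obtain F K where FK: "finite F" "finite K" "F \<subseteq> f t" "f t \<inter> K = {}"
      "{S. S \<subseteq> Y \<and> F \<subseteq> S \<and> S \<inter> K = {}} \<subseteq> U"
      using U unfolding openin_fell_discrete_iff by meson
    define W where "W = {s \<in> topspace T. (\<forall>e\<in>F. e \<in> f s) \<and> (\<forall>e\<in>K \<inter> Y. e \<notin> f s)}"
    have W: "W = \<Inter>(insert (topspace T)
      ((\<lambda>e. {s \<in> topspace T. e \<in> f s}) ` F \<union> (\<lambda>e. {s \<in> topspace T. e \<notin> f s}) ` (K \<inter> Y)))"
      unfolding W_def by auto
    have "openin T W"
      unfolding W using FK(1-3) sub[OF t(1)]
      by (intro openin_Inter) (auto intro: pos neg)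
    moreover have "t \<in> W"
      using t FK by (auto simp: W_def)
    moreover have "W \<subseteq> {t \<in> topspace T. f t \<in> U}"
    proof
      fix s assume s: "s \<in> W"
      then have "f s \<subseteq> Y"
        using sub by (auto simp: W_def)
      moreover from this s have "F \<subseteq> f s" "f s \<inter> K = {}"
        by (auto simp: W_def)
      ultimately show "s \<in> {t \<in> topspace T. f t \<in> U}"
        using FK(5) s by (auto simp: W_def)
    qed
    ultimately show "\<exists>W. openin T W \<and> t \<in> W \<and> W \<subseteq> {t \<in> topspace T. f t \<in> U}"
      by blast
  qed
qed

lemma openin_subtopology_fell_discrete_mem:
  assumes "e \<in> Y"
  shows "openin (subtopology (fell_topology (discrete_topology Y)) \<S>)
      {S \<in> topspace (subtopology (fell_topology (discrete_topology Y)) \<S>). e \<in> S}" (is ?mem)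
    and "openin (subtopology (fell_topology (discrete_topology Y)) \<S>)
      {S \<in> topspace (subtopology (fell_topology (discrete_topology Y)) \<S>). e \<notin> S}" (is ?not_mem)
proof -
  have "openin (fell_topology (discrete_topology Y)) {T. T \<subseteq> Y \<and> e \<in> T}"
    "openin (fell_topology (discrete_topology Y)) {T. T \<subseteq> Y \<and> e \<notin> T}"
    using openin_fell_discrete_cylinder[of "{e}" "{}" Y]
      openin_fell_discrete_cylinder[of "{}" "{e}" Y] by simp_all
  from this[THEN openin_subtopology_Int2[where S = \<S>]] show ?mem ?not_mem
    by (auto simp: Int_def conj_commute conj_left_commute)
qed

section \<open>Partial automorphisms as relations\<close>

text \<open>These are exactly the graphs of the maps in \<^const>\<open>cyc_pAut\<close>. Injectivity is phrased through the
  converse relation, which makes the definition symmetric under the involution, and each condition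
  involves at most three pairs, which makes it closed.\<close>

definition pAut_graphs ::
    "'a set \<Rightarrow> ('a \<Rightarrow> 'a \<Rightarrow> 'a \<Rightarrow> bool) \<Rightarrow> ('a \<times> 'a) set set" where
  "pAut_graphs X R = {S. S \<subseteq> X \<times> X \<and> single_valued S \<and> single_valued (S\<inverse>) \<and>
     (\<forall>(a, a')\<in>S. \<forall>(b, b')\<in>S. \<forall>(c, c')\<in>S. R a b c \<longleftrightarrow> R a' b' c')}"

lemma pAut_graphsI:
  assumes "S \<subseteq> X \<times> X"
    and "\<And>a b c. (a, b) \<in> S \<Longrightarrow> (a, c) \<in> S \<Longrightarrow> b = c"
    and "\<And>a b c. (b, a) \<in> S \<Longrightarrow> (c, a) \<in> S \<Longrightarrow> b = c"
    and "\<And>a a' b b' c c'. (a, a') \<in> S \<Longrightarrow> (b, b') \<in> S \<Longrightarrow> (c, c') \<in> S \<Longrightarrow> R a b c \<longleftrightarrow> R a' b' c'"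
  shows "S \<in> pAut_graphs X R"
  unfolding pAut_graphs_def
proof (intro CollectI conjI)
  show "single_valued S"
    by (rule single_valuedI) (rule assms(2))
  show "single_valued (S\<inverse>)"
    by (rule single_valuedI) (unfold converse_iff, rule assms(3))
  show "\<forall>(a, a')\<in>S. \<forall>(b, b')\<in>S. \<forall>(c, c')\<in>S. R a b c \<longleftrightarrow> R a' b' c'"
    by clarify (rule assms(4))
qed (fact assms(1))

lemma pAut_graphsD:
  assumes "S \<in> pAut_graphs X R"
  shows "S \<subseteq> X \<times> X"
    and "(a, b) \<in> S \<Longrightarrow> (a, c) \<in> S \<Longrightarrow> b = c"
    and "(b, a) \<in> S \<Longrightarrow> (c, a) \<in> S \<Longrightarrow> b = c"
    and "(a, a') \<in> S \<Longrightarrow> (b, b') \<in> S \<Longrightarrow> (c, c') \<in> S \<Longrightarrow> R a b c \<longleftrightarrow> R a' b' c'"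
proof -
  show "S \<subseteq> X \<times> X"
    using assms by (simp add: pAut_graphs_def)
  show "b = c" if "(a, b) \<in> S" "(a, c) \<in> S"
    using assms that single_valuedD[of S a b c] by (simp add: pAut_graphs_def)
  show "b = c" if "(b, a) \<in> S" "(c, a) \<in> S"
    using assms that single_valuedD[of "S\<inverse>" a b c] by (simp add: pAut_graphs_def)
  show "R a b c \<longleftrightarrow> R a' b' c'" if "(a, a') \<in> S" "(b, b') \<in> S" "(c, c') \<in> S"
    using assms that unfolding pAut_graphs_def by fast
qed

lemma graph_image_cyc_pAut: "Map.graph ` cyc_pAut X R = pAut_graphs X R"
proof (intro equalityI subsetI)
  fix S assume "S \<in> Map.graph ` cyc_pAut X R"
  then obtain p where p: "p \<in> cyc_pAut X R" and S: "S = Map.graph p"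
    by blast
  show "S \<in> pAut_graphs X R"
  proof (rule pAut_graphsI)
    show "S \<subseteq> X \<times> X"
      using p unfolding S cyc_pAut_def by (auto simp: Map.graph_def dom_def ran_def)
  next
    fix a b c assume "(b, a) \<in> S" "(c, a) \<in> S"
    then have "p b = Some a" "p c = Some a"
      unfolding S by (auto dest: in_graphD)
    moreover have "inj_on p (dom p)"
      using p unfolding cyc_pAut_def by blast
    ultimately show "b = c"
      by (metis domI inj_onD)
  next
    fix a a' b b' c c' assume "(a, a') \<in> S" "(b, b') \<in> S" "(c, c') \<in> S"
    then have "p a = Some a'" "p b = Some b'" "p c = Some c'"
      unfolding S by (auto dest: in_graphD)
    moreover from this have "a \<in> dom p" "b \<in> dom p" "c \<in> dom p"
      by auto
    moreover have "\<forall>a\<in>dom p. \<forall>b\<in>dom p. \<forall>c\<in>dom p.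
        R a b c \<longleftrightarrow> R (the (p a)) (the (p b)) (the (p c))"
      using p unfolding cyc_pAut_def by blast
    ultimately show "R a b c \<longleftrightarrow> R a' b' c'"
      by simp
  next
    fix a b c assume "(a, b) \<in> S" "(a, c) \<in> S"
    then have "p a = Some b" "p a = Some c"
      unfolding S by (auto dest: in_graphD)
    then show "b = c"
      by simp
  qed
next
  fix S assume S: "S \<in> pAut_graphs X R"
  define p where "p x = (if x \<in> Domain S then Some (THE y. (x, y) \<in> S) else None)" for x
  have "(THE y. (x, y) \<in> S) = y" if "(x, y) \<in> S" for x y
    using that pAut_graphsD(2)[OF S] by (intro the_equality)
  then have p: "p x = Some y \<longleftrightarrow> (x, y) \<in> S" for x y
    by (auto simp: p_def)
  have "p \<in> cyc_pAut X R"
    unfolding cyc_pAut_def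
  proof (intro CollectI conjI ballI)
    show "dom p \<subseteq> X" "ran p \<subseteq> X"
      using pAut_graphsD(1)[OF S] by (auto simp: dom_def ran_def p)
    show "inj_on p (dom p)"
      by (rule inj_onI) (metis domD p pAut_graphsD(3)[OF S])
    show "R a b c \<longleftrightarrow> R (the (p a)) (the (p b)) (the (p c))"
      if "a \<in> dom p" "b \<in> dom p" "c \<in> dom p" for a b c
    proof (rule pAut_graphsD(4)[OF S])
      show "(a, the (p a)) \<in> S" "(b, the (p b)) \<in> S" "(c, the (p c)) \<in> S"
        using that by (auto simp: p[symmetric])
    qed
  qed
  moreover have "S = Map.graph p"
    by (auto simp: Map.graph_def p)
  ultimately show "S \<in> Map.graph ` cyc_pAut X R"
    by blast
qed

lemma inj_graph: "inj Map.graph"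
proof (rule injI, rule ext)
  fix p q :: "'a \<rightharpoonup> 'b" and x
  assume "Map.graph p = Map.graph q"
  then have "\<forall>y. p x = Some y \<longleftrightarrow> q x = Some y"
    by (simp add: Map.graph_def set_eq_iff)
  then show "p x = q x"
    by (cases "q x") (auto simp: not_None_eq[symmetric] simp del: not_None_eq)
qed

lemma rel_mult_in_pAut_graphs:
  assumes A: "A \<in> pAut_graphs X R" and B: "B \<in> pAut_graphs X R"
  shows "rel_mult B A \<in> pAut_graphs X R"
proof (rule pAut_graphsI)
  show "rel_mult B A \<subseteq> X \<times> X"
    using pAut_graphsD(1)[OF A] pAut_graphsD(1)[OF B] by (auto simp: rel_mult_def)
  show "b = c" if "(a, b) \<in> rel_mult B A" "(a, c) \<in> rel_mult B A" for a b c
    using that pAut_graphsD(2)[OF A] pAut_graphsD(2)[OF B] unfolding rel_mult_def by blast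
  show "b = c" if "(b, a) \<in> rel_mult B A" "(c, a) \<in> rel_mult B A" for a b c
    using that pAut_graphsD(3)[OF A] pAut_graphsD(3)[OF B] unfolding rel_mult_def by blast
  show "R a b c \<longleftrightarrow> R a' b' c'"
    if mem: "(a, a') \<in> rel_mult B A" "(b, b') \<in> rel_mult B A" "(c, c') \<in> rel_mult B A"
    for a a' b b' c c'
  proof -
    obtain u v w where uvw: "(a, u) \<in> A" "(b, v) \<in> A" "(c, w) \<in> A"
      "(u, a') \<in> B" "(v, b') \<in> B" "(w, c') \<in> B"
      using mem unfolding rel_mult_def by blast
    show ?thesis
      using pAut_graphsD(4)[OF A uvw(1-3)] pAut_graphsD(4)[OF B uvw(4-6)] by simp
  qed
qed

lemma converse_in_pAut_graphs:
  assumes "A \<in> pAut_graphs X R"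
  shows "A\<inverse> \<in> pAut_graphs X R"
proof (rule pAut_graphsI)
  show "A\<inverse> \<subseteq> X \<times> X"
    using pAut_graphsD(1)[OF assms] by blast
next
  show "b = c" if "(a, b) \<in> A\<inverse>" "(a, c) \<in> A\<inverse>" for a b c
    using that by (auto intro: pAut_graphsD(3)[OF assms])
  show "b = c" if "(b, a) \<in> A\<inverse>" "(c, a) \<in> A\<inverse>" for a b c
    using that by (auto intro: pAut_graphsD(2)[OF assms])
  show "R a b c \<longleftrightarrow> R a' b' c'" if "(a, a') \<in> A\<inverse>" "(b, b') \<in> A\<inverse>" "(c, c') \<in> A\<inverse>"
    for a a' b b' c c'
    using pAut_graphsD(4)[OF assms, of a' a b' b c' c] that by simp
qed

abbreviation pAut_topology ::
    "'a set \<Rightarrow> ('a \<Rightarrow> 'a \<Rightarrow> 'a \<Rightarrow> bool) \<Rightarrow> ('a \<times> 'a) set topology" where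
  "pAut_topology X R \<equiv>
     subtopology (fell_topology (discrete_topology (X \<times> X))) (pAut_graphs X R)"

lemma topspace_pAut_topology: "topspace (pAut_topology X R) = pAut_graphs X R"
proof -
  have "pAut_graphs X R \<subseteq> Pow (X \<times> X)"
    by (rule subsetI) (rule PowI, rule pAut_graphsD(1))
  then show ?thesis
    by auto
qed

lemma continuous_map_into_pAut_topology:
  assumes sub: "\<And>t. t \<in> topspace T \<Longrightarrow> f t \<in> pAut_graphs X R"
    and pos: "\<And>e. e \<in> X \<times> X \<Longrightarrow> openin T {t \<in> topspace T. e \<in> f t}"
    and neg: "\<And>e. e \<in> X \<times> X \<Longrightarrow> openin T {t \<in> topspace T. e \<notin> f t}"
  shows "continuous_map T (pAut_topology X R) f"
proof (rule continuous_map_into_subtopology)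
  show "continuous_map T (fell_topology (discrete_topology (X \<times> X))) f"
    using pAut_graphsD(1)[OF sub] pos neg by (rule continuous_map_into_fell_discrete)
  show "f \<in> topspace T \<rightarrow> pAut_graphs X R"
    using sub by (rule Pi_I)
qed

text \<open>A pair \<open>(x, z)\<close> lies in the product with \<open>A\<close> iff one particular pair \<open>(x, y)\<close> lies in the variable
  factor, where \<open>y\<close> is the preimage of \<open>z\<close> under \<open>A\<close>; if there is none, it never does. Both
  alternatives are clopen.\<close>

lemma continuous_rel_mult_left:
  assumes A: "A \<in> pAut_graphs X R"
  shows "continuous_map (pAut_topology X R) (pAut_topology X R) (rel_mult A)"
proof -
  let ?T = "pAut_topology X R"
  have "openin ?T {S \<in> topspace ?T. e \<in> rel_mult A S} \<and>
    openin ?T {S \<in> topspace ?T. e \<notin> rel_mult A S}" if e: "e \<in> X \<times> X" for e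
  proof -
    obtain x z where xz: "e = (x, z)" "x \<in> X"
      using e by auto
    show ?thesis
    proof (cases "z \<in> Range A")
      case False
      then have "e \<notin> rel_mult A S" for S
        by (auto simp: xz rel_mult_def)
      then show ?thesis
        by (simp del: topspace_subtopology)
    next
      case True
      then obtain y where y: "(y, z) \<in> A"
        by blast
      \<comment> \<open>Injectivity of \<open>A\<close> makes \<open>y\<close> the only possible intermediate point.\<close>
      then have "e \<in> rel_mult A S \<longleftrightarrow> (x, y) \<in> S" for S
        using pAut_graphsD(3)[OF A] by (auto simp: xz rel_mult_def)
      moreover have "(x, y) \<in> X \<times> X"
        using y xz pAut_graphsD(1)[OF A] by blast
      ultimately show ?thesis
        using openin_subtopology_fell_discrete_mem[of "(x, y)" "X \<times> X" "pAut_graphs X R"]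
        by (simp del: topspace_subtopology)
    qed
  qed
  then show ?thesis
    using rel_mult_in_pAut_graphs[OF _ A]
    by (intro continuous_map_into_pAut_topology) (simp_all only: topspace_pAut_topology)
qed

lemma continuous_converse:
  "continuous_map (pAut_topology X R) (pAut_topology X R) (\<lambda>A. A\<inverse>)"
proof (rule continuous_map_into_pAut_topology)
  let ?T = "pAut_topology X R"
  show "S\<inverse> \<in> pAut_graphs X R" if "S \<in> topspace ?T" for S
    using that unfolding topspace_pAut_topology by (rule converse_in_pAut_graphs)
  show "openin ?T {S \<in> topspace ?T. e \<in> S\<inverse>}" if "e \<in> X \<times> X" for e
    using that openin_subtopology_fell_discrete_mem(1)[of "prod.swap e" "X \<times> X" "pAut_graphs X R"]
    by (cases e) (simp del: topspace_subtopology)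
  show "openin ?T {S \<in> topspace ?T. e \<notin> S\<inverse>}" if "e \<in> X \<times> X" for e
    using that openin_subtopology_fell_discrete_mem(2)[of "prod.swap e" "X \<times> X" "pAut_graphs X R"]
    by (cases e) (simp del: topspace_subtopology)
qed

text \<open>The involution exchanges the two sides of a product, so continuity on one side gives continuity
  on the other.\<close>

lemma continuous_rel_mult_right:
  assumes A: "A \<in> pAut_graphs X R"
  shows "continuous_map (pAut_topology X R) (pAut_topology X R) (\<lambda>B. rel_mult B A)"
proof -
  have "(\<lambda>B. rel_mult B A) = (\<lambda>B. B\<inverse>) \<circ> (rel_mult (A\<inverse>) \<circ> (\<lambda>B. B\<inverse>))"
    by (auto simp: rel_mult_def converse_relcomp fun_eq_iff)
  then show ?thesis
    using continuous_map_compose[OF continuous_map_compose[OF continuous_converse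
          continuous_rel_mult_left[OF converse_in_pAut_graphs[OF A]]] continuous_converse]
    by simp
qed

section \<open>Finite subsets of a cyclic order\<close>

locale cyclic_order =
  fixes X :: "'a set" and R :: "'a \<Rightarrow> 'a \<Rightarrow> 'a \<Rightarrow> bool"
  assumes cyclically_ordered: "cyclically_ordered X R"
begin

lemma cyclic: "a \<in> X \<Longrightarrow> b \<in> X \<Longrightarrow> c \<in> X \<Longrightarrow> R a b c \<Longrightarrow> R b c a"
  using cyclically_ordered[unfolded cyclically_ordered_def, THEN conjunct2, THEN conjunct1] by blast

lemma asymmetric: "a \<in> X \<Longrightarrow> b \<in> X \<Longrightarrow> c \<in> X \<Longrightarrow> R a b c \<Longrightarrow> \<not> R b a c"
  using cyclically_ordered[unfolded cyclically_ordered_def, THEN conjunct2, THEN conjunct2, THEN conjunct1] by blast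

lemma transitive:
  "a \<in> X \<Longrightarrow> b \<in> X \<Longrightarrow> c \<in> X \<Longrightarrow> d \<in> X \<Longrightarrow> R a b c \<Longrightarrow> R a c d \<Longrightarrow> R a b d"
  using cyclically_ordered[unfolded cyclically_ordered_def, THEN conjunct2, THEN conjunct2, THEN conjunct2,
      THEN conjunct1] by blast

lemma complete:
  "a \<in> X \<Longrightarrow> b \<in> X \<Longrightarrow> c \<in> X \<Longrightarrow> a \<noteq> b \<Longrightarrow> b \<noteq> c \<Longrightarrow> a \<noteq> c \<Longrightarrow> R a b c \<or> R a c b"
  using cyclically_ordered[unfolded cyclically_ordered_def, THEN conjunct2, THEN conjunct2, THEN conjunct2,
      THEN conjunct2] by blast

lemma distinct_if_R:
  assumes "a \<in> X" "b \<in> X" "c \<in> X" "R a b c"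
  shows "a \<noteq> b \<and> b \<noteq> c \<and> a \<noteq> c"
  using assms asymmetric[of a b c] cyclic[of a b c]
    asymmetric[of b c a] cyclic[of b c a] asymmetric[of c a b] by blast

lemma not_R_iff:
  assumes "a \<in> X" "b \<in> X" "c \<in> X" "a \<noteq> b" "b \<noteq> c" "a \<noteq> c"
  shows "\<not> R a b c \<longleftrightarrow> R a c b"
  using assms asymmetric[of a b c] cyclic[of a c b] cyclic[of c b a] complete[of a b c] by blast

lemma transitive_tail:
  assumes "a \<in> X" "b \<in> X" "c \<in> X" "d \<in> X" "R a b c" "R a c d"
  shows "R b c d"
  using assms cyclic[of a b c] cyclic[of b c a] cyclic[of a c d] transitive[of c d a b]
    cyclic[of c d b] cyclic[of d b c] by blast

text \<open>Cutting the circle at \<open>x\<close> makes \<open>R x\<close> a strict linear order on the remaining points.\<close>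

lemma cut_order:
  assumes "x \<in> X" "A \<subseteq> X"
  shows "asymp_on A (R x)" and "transp_on A (R x)"
    and "x \<notin> A \<Longrightarrow> totalp_on A (R x)"
proof -
  show "asymp_on A (R x)"
  proof (rule asymp_onI)
    fix a b assume "a \<in> A" "b \<in> A" "R x a b"
    then show "\<not> R x b a"
      using assms asymmetric[of a b x] cyclic[of x a b] cyclic[of x b a] by blast
  qed
  show "transp_on A (R x)"
  proof (rule transp_onI)
    fix a b c assume "a \<in> A" "b \<in> A" "c \<in> A" "R x a b" "R x b c"
    then show "R x a c"
      using assms transitive[of x a b c] by blast
  qed
  show "totalp_on A (R x)" if "x \<notin> A"
  proof (rule totalp_onI)
    fix a b assume "a \<in> A" "b \<in> A" "a \<noteq> b"
    then show "R x a b \<or> R x b a"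
      using assms complete[of x a b] that by blast
  qed
qed

lemma finite_sorted_enumeration:
  assumes "finite A" "A \<subseteq> X" "x \<in> X" "x \<notin> A"
  shows "\<exists>xs. set xs = A \<and> distinct xs \<and> sorted_wrt (R x) xs"
  using assms
proof (induction A rule: finite_psubset_induct)
  case (psubset A)
  show ?case
  proof (cases "A = {}")
    case False
    obtain m where m: "m \<in> A" "\<forall>y\<in>A. y \<noteq> m \<longrightarrow> R x m y"
      using Finite_Set.bex_least_element[OF psubset.hyps, of "R x"] False
        cut_order[OF psubset.prems(2,1)] psubset.prems(3) by meson
    obtain xs where "set xs = A - {m} \<and> distinct xs \<and> sorted_wrt (R x) xs"
      using psubset.IH[of "A - {m}"] psubset.prems m by blast
    then show ?thesis
      using m by (intro exI[of _ "m # xs"]) auto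
  qed auto
qed

text \<open>Start the cycle at any point \<open>x\<close> of \<open>A\<close> and list the others in the linear order cut at \<open>x\<close>.\<close>

lemma finite_enumeration_by_cycle:
  assumes "finite A" "A \<subseteq> X" "A \<noteq> {}"
  shows "\<exists>xs. set xs = A \<and> distinct xs \<and>
    (\<forall>i j k. i < j \<and> j < k \<and> k < length xs \<longrightarrow> R (xs ! i) (xs ! j) (xs ! k))"
proof -
  obtain x where x: "x \<in> A" "x \<in> X"
    using assms by blast
  obtain xs where xs: "set xs = A - {x}" "distinct xs" "sorted_wrt (R x) xs"
    using finite_sorted_enumeration[of "A - {x}" x] assms x by blast
  have mem: "i < length xs \<Longrightarrow> xs ! i \<in> X" for i
    using xs(1) assms(2) nth_mem by blast
  have sorted: "i < j \<Longrightarrow> j < length xs \<Longrightarrow> R x (xs ! i) (xs ! j)" for i j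
    using xs(3) by (simp add: sorted_wrt_iff_nth_less)
  have "R ((x # xs) ! i) ((x # xs) ! j) ((x # xs) ! k)"
    if ijk: "i < j" "j < k" "k < length (x # xs)" for i j k
  proof -
    obtain j' k' where jk: "j = Suc j'" "k = Suc k'"
      using ijk less_imp_Suc_add[of i j] less_imp_Suc_add[of j k] by blast
    show ?thesis
    proof (cases i)
      case 0
      then show ?thesis
        using ijk jk by (auto intro: sorted)
    next
      case (Suc i')
      have "R x (xs ! i') (xs ! j')" "R x (xs ! j') (xs ! k')"
        using ijk jk Suc by (auto intro: sorted)
      then show ?thesis
        using ijk jk Suc mem[of i'] mem[of j'] mem[of k'] x(2)
          transitive_tail[of x "xs ! i'" "xs ! j'" "xs ! k'"] by simp
    qed
  qed
  then show ?thesis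
    using xs x by (intro exI[of _ "x # xs"]) auto
qed

text \<open>Two points in the same gap of \<open>A\<close> stand in the same relation to all points of \<open>A\<close>. Here the
  gap is named by its right end \<open>a\<close>: nothing of \<open>A\<close> lies between \<open>x\<close> and \<open>a\<close>.\<close>

lemma same_gap_iff:
  assumes A: "A \<subseteq> X" and x: "x \<in> X" and y: "y \<in> X"
    and a: "\<forall>b\<in>A. b \<noteq> a \<longrightarrow> R x a b" "a \<in> A" and xya: "R x y a"
    and b: "b \<in> A" and c: "c \<in> A"
  shows "R x b c \<longleftrightarrow> R y b c"
proof -
  have A_X: "d \<in> X" if "d \<in> A" for d
    using A that by blast
  have R_x_y: "R x y d" if d: "d \<in> A" for d
  proof (cases "d = a")
    case False
    then show ?thesis
      using a d xya transitive[OF x y A_X[OF a(2)] A_X[OF d]] by simp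
  qed (simp add: xya)
  have R_y: "R y d e" if "R x d e" "d \<in> A" "e \<in> A" for d e
    using transitive_tail[OF x y A_X A_X R_x_y] that by simp
  have ne: "x \<noteq> d \<and> y \<noteq> d" if d: "d \<in> A" for d
    using distinct_if_R[OF x y A_X[OF d] R_x_y[OF d]] by simp
  show ?thesis
  proof (cases "b = c")
    case True
    then show ?thesis
      using distinct_if_R[OF x A_X[OF b] A_X[OF c]] distinct_if_R[OF y A_X[OF b] A_X[OF c]]
      by auto
  next
    case False
    then have "\<not> R x b c \<longleftrightarrow> R x c b" "\<not> R y b c \<longleftrightarrow> R y c b"
      using not_R_iff[OF x A_X[OF b] A_X[OF c]] not_R_iff[OF y A_X[OF b] A_X[OF c]]
        ne[OF b] ne[OF c] by simp_all
    then show ?thesis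
      using R_y[OF _ b c] R_y[OF _ c b] by blast
  qed
qed

end

section \<open>Automorphisms of an ultrahomogeneous cyclic order\<close>

lemma cyc_AutD:
  assumes "g \<in> cyc_Aut X R"
  shows "x \<in> X \<Longrightarrow> g x \<in> X" and "inj_on g X"
    and "a \<in> X \<Longrightarrow> b \<in> X \<Longrightarrow> c \<in> X \<Longrightarrow> R a b c \<longleftrightarrow> R (g a) (g b) (g c)"
proof -
  show "g x \<in> X" if "x \<in> X"
    using assms that by (auto simp: cyc_Aut_def bij_betw_def)
  show "inj_on g X"
    using assms by (simp add: cyc_Aut_def bij_betw_def)
  show "R a b c \<longleftrightarrow> R (g a) (g b) (g c)" if "a \<in> X" "b \<in> X" "c \<in> X"
    using assms that unfolding cyc_Aut_def by fast
qed

lemma compose_in_cyc_Aut: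
  assumes g: "g \<in> cyc_Aut X R" and h: "h \<in> cyc_Aut X R"
  shows "compose X g h \<in> cyc_Aut X R"
  unfolding cyc_Aut_def
proof (intro CollectI conjI ballI)
  have "bij_betw g X X" "bij_betw h X X"
    using assms by (simp_all add: cyc_Aut_def)
  then show "bij_betw (compose X g h) X X"
    by (rule bij_betw_compose[rotated])
  show "R a b c \<longleftrightarrow> R (compose X g h a) (compose X g h b) (compose X g h c)"
    if "a \<in> X" "b \<in> X" "c \<in> X" for a b c
    using cyc_AutD(3)[OF h that] cyc_AutD(3)[OF g that[THEN cyc_AutD(1)[OF h]]] that
    by (simp add: compose_eq)
qed (rule compose_extensional)

locale ultrahomogeneous_cyclic_order = cyclic_order +
  assumes infinite: "infinite X" and ultrahomogeneous: "ultrahomogeneous X R"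
begin

text \<open>Ultrahomogeneity speaks of cycles; listing a finite set as a cycle turns it into the
  extension property for finite partial automorphisms. Preservation of \<open>R\<close> in one direction suffices,
  since \<open>R\<close> decides the orientation of every triple of distinct points.\<close>

lemma finite_extends_to_aut:
  assumes A: "finite A" "A \<subseteq> X" and f: "inj_on f A" "f ` A \<subseteq> X"
    and pres: "\<And>a b c. a \<in> A \<Longrightarrow> b \<in> A \<Longrightarrow> c \<in> A \<Longrightarrow> R a b c \<Longrightarrow> R (f a) (f b) (f c)"
  shows "\<exists>g\<in>cyc_Aut X R. \<forall>a\<in>A. g a = f a"
proof (cases "A = {}")
  case True
  obtain x where "x \<in> X"
    using infinite by fastforce
  then have "is_cycle X R [x]"
    by (simp add: is_cycle_def)
  then show ?thesis
    using ultrahomogeneous True unfolding ultrahomogeneous_def by blast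
next
  case False
  obtain xs where xs: "set xs = A" "distinct xs"
    and cyc: "\<And>i j k. i < j \<Longrightarrow> j < k \<Longrightarrow> k < length xs \<Longrightarrow> R (xs ! i) (xs ! j) (xs ! k)"
    using finite_enumeration_by_cycle[OF A False] by blast
  have mem: "i < length xs \<Longrightarrow> xs ! i \<in> A" for i
    using xs(1) nth_mem by blast
  have "length xs > 0"
    using False xs(1) by auto
  then consider "length xs = 1" | "length xs = 2" | "3 \<le> length xs"
    by linarith
  then have "is_cycle X R xs \<and> is_cycle X R (map f xs)"
  proof cases
    case 1
    then show ?thesis
      using xs f A by (auto simp: is_cycle_def)
  next
    case 2
    then have "xs ! 0 \<noteq> xs ! 1" "xs ! 0 \<in> A" "xs ! 1 \<in> A"
      using xs(2) mem by (auto simp: nth_eq_iff_index_eq)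
    then show ?thesis
      using 2 xs f A inj_onD[OF f(1), of "xs ! 0" "xs ! 1"] by (auto simp: is_cycle_def)
  next
    case 3
    have "R (map f xs ! i) (map f xs ! j) (map f xs ! k)"
      if "i < j" "j < k" "k < length xs" for i j k
      using pres[OF mem mem mem cyc[OF that]] that by simp
    then show ?thesis
      using 3 xs f A cyc by (auto simp: is_cycle_def)
  qed
  then obtain g where g: "g \<in> cyc_Aut X R" "\<forall>i<length xs. g (xs ! i) = map f xs ! i"
    using ultrahomogeneous unfolding ultrahomogeneous_def by (metis length_map)
  then have "\<forall>a\<in>A. g a = f a"
    using xs(1) by (metis in_set_conv_nth nth_map)
  then show ?thesis
    using g(1) by blast
qed

text \<open>Some pair of points has a third one between them, and any two pairs of distinct points are
  conjugate.\<close>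

lemma between_exists:
  assumes "x \<in> X" "z \<in> X" "x \<noteq> z"
  shows "\<exists>y\<in>X. R x y z"
proof -
  obtain B where B: "B \<subseteq> X" "card B = 3"
    using infinite by (meson infinite_arbitrarily_large)
  then obtain a b c where "a \<in> X" "b \<in> X" "c \<in> X" "a \<noteq> b" "b \<noteq> c" "a \<noteq> c"
    by (auto simp: card_3_iff)
  then obtain u v w where R: "u \<in> X" "v \<in> X" "w \<in> X" "R u v w"
    using complete by blast
  then have "u \<noteq> w"
    using distinct_if_R by blast
  \<comment> \<open>A map of just two points preserves \<open>R\<close> vacuously.\<close>
  moreover from this have "\<not> R p q r" if "p \<in> {u, w}" "q \<in> {u, w}" "r \<in> {u, w}" for p q r
    using distinct_if_R[of p q r] that R by auto
  ultimately obtain g where g: "g \<in> cyc_Aut X R"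
    "\<forall>a\<in>{u, w}. g a = (if a = u then x else z)"
    using finite_extends_to_aut[of "{u, w}" "\<lambda>a. if a = u then x else z"] assms R
    by (force simp: inj_on_def)
  then have "R x (g v) z"
    using cyc_AutD(3)[OF g(1)] R \<open>u \<noteq> w\<close> by fastforce
  then show ?thesis
    using cyc_AutD(1)[OF g(1)] R by blast
qed

text \<open>A finite interval would have a point \<open>m\<close> closest to \<open>x\<close>, with nothing between \<open>x\<close> and \<open>m\<close>.\<close>

lemma infinite_interval:
  assumes "x \<in> X" "z \<in> X" "x \<noteq> z"
  shows "infinite {y \<in> X. R x y z}"
proof
  let ?I = "{y \<in> X. R x y z}"
  assume "finite ?I"
  moreover have "?I \<noteq> {}"
    using between_exists[OF assms] by blast
  ultimately obtain m where m: "m \<in> ?I" "\<forall>y\<in>?I. y \<noteq> m \<longrightarrow> \<not> R x y m"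
    using Finite_Set.bex_min_element[of ?I "R x"] cut_order[OF assms(1), of ?I] by blast
  then have "x \<noteq> m"
    using distinct_if_R assms by blast
  then obtain y where y: "y \<in> X" "R x y m"
    using between_exists[of x m] assms m by blast
  then have "y \<in> ?I" "y \<noteq> m"
    using transitive[of x y m z] distinct_if_R[of x y m] assms m by auto
  then show False
    using m y by blast
qed

text \<open>A point \<open>y\<close> in the same gap of \<open>A\<close> as \<open>x\<close> has the same relations to \<open>A\<close>, so moving \<open>x\<close> to \<open>y\<close> while
  fixing \<open>A\<close> is a finite partial automorphism and extends to an automorphism. The part of the gap
  between \<open>x\<close> and its successor in \<open>A\<close> already contains infinitely many such points.
  If \<open>A\<close> is empty, every point of \<open>X\<close> will do.\<close>

lemma infinite_orbit_of_stabilizer: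
  assumes A: "finite A" "A \<subseteq> X" and x: "x \<in> X" "x \<notin> A"
  shows "infinite {h x | h. h \<in> cyc_Aut X R \<and> (\<forall>a\<in>A. h a = a)}"
proof -
  have orbit: "\<exists>h\<in>cyc_Aut X R. h x = y \<and> (\<forall>a\<in>A. h a = a)"
    if y: "y \<in> X" "y \<notin> A" and same: "\<And>b c. b \<in> A \<Longrightarrow> c \<in> A \<Longrightarrow> R x b c \<Longrightarrow> R y b c" for y
  proof -
    let ?f = "\<lambda>a. if a = x then y else a"
    have pres: "R (?f a) (?f b) (?f c)"
      if mem: "a \<in> insert x A" "b \<in> insert x A" "c \<in> insert x A" and R: "R a b c" for a b c
    proof -
      have "a \<in> X" "b \<in> X" "c \<in> X"
        using mem A x by auto
      \<comment> \<open>The relations to \<open>x\<close> are known with \<open>x\<close> in first position; cyclicity rotates the others there.\<close>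
      then show ?thesis
        using distinct_if_R[of a b c] cyclic[of a b c] cyclic[of b c a]
          same[of b c] same[of c a] same[of a b]
          cyclic[of y c a] cyclic[of c a y] cyclic[of y a b] R mem y
        by (auto split: if_splits)
    qed
    have "\<exists>h\<in>cyc_Aut X R. \<forall>a\<in>insert x A. h a = ?f a"
    proof (rule finite_extends_to_aut)
      show "inj_on ?f (insert x A)"
        using y(2) by (auto simp: inj_on_def)
      show "finite (insert x A)" "insert x A \<subseteq> X" "?f ` insert x A \<subseteq> X"
        using A x y(1) by auto
    qed (rule pres)
    then obtain h where h: "h \<in> cyc_Aut X R" "\<forall>a\<in>insert x A. h a = ?f a"
      by blast
    show ?thesis
    proof (intro bexI[of _ h] conjI ballI)
      show "h x = y"
        using h(2) by simp
      show "h a = a" if "a \<in> A" for a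
        using h(2) that x(2) by auto
    qed (rule h(1))
  qed
  show ?thesis
  proof (cases "A = {}")
    case True
    have "X \<subseteq> {h x | h. h \<in> cyc_Aut X R \<and> (\<forall>a\<in>A. h a = a)}"
    proof
      fix y assume "y \<in> X"
      then obtain h where "h \<in> cyc_Aut X R" "h x = y"
        using orbit[of y] True by auto
      then show "y \<in> {h x | h. h \<in> cyc_Aut X R \<and> (\<forall>a\<in>A. h a = a)}"
        using True by blast
    qed
    then show ?thesis
      using infinite finite_subset by blast
  next
    case False
    obtain a where a: "a \<in> A" "\<forall>b\<in>A. b \<noteq> a \<longrightarrow> R x a b"
      using Finite_Set.bex_least_element[OF A(1), of "R x"] False
        cut_order[OF x(1) A(2)] x(2) by meson
    have "y \<in> {h x | h. h \<in> cyc_Aut X R \<and> (\<forall>a\<in>A. h a = a)}" if y: "y \<in> X" "R x y a" for y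
    proof -
      have "y \<notin> A"
      proof
        assume "y \<in> A"
        moreover have "a \<in> X"
          using a(1) A(2) by blast
        then have "x \<noteq> y \<and> y \<noteq> a \<and> x \<noteq> a" "y \<noteq> a \<Longrightarrow> x \<noteq> y \<Longrightarrow> x \<noteq> a \<Longrightarrow> \<not> R x a y"
          using distinct_if_R[OF x(1) y(1) _ y(2)] not_R_iff[of x y a] x(1) y by auto
        ultimately show False
          using a(2) by simp
      qed
      have "R y b c" if "b \<in> A" "c \<in> A" "R x b c" for b c
        using same_gap_iff[OF A(2) x(1) y(1) a(2,1) y(2) that(1,2)] that(3) by simp
      then obtain h where "h \<in> cyc_Aut X R" "h x = y" "\<forall>a\<in>A. h a = a"
        using orbit[OF y(1) \<open>y \<notin> A\<close>] by blast
      then show ?thesis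
        by blast
    qed
    then have "{y \<in> X. R x y a} \<subseteq> {h x | h. h \<in> cyc_Aut X R \<and> (\<forall>a\<in>A. h a = a)}"
      by blast
    moreover have "infinite {y \<in> X. R x y a}"
      using infinite_interval[of x a] a A x by blast
    ultimately show ?thesis
      using finite_subset by blast
  qed
qed

text \<open>Induction over \<open>C\<close>: precomposing with an automorphism that fixes \<open>A\<close> and the points treated before
  keeps their images and leaves infinitely many choices for the image of the next point.\<close>

lemma aut_agreeing_and_avoiding:
  assumes g: "g \<in> cyc_Aut X R" and A: "finite A" "A \<subseteq> X" and B: "finite B"
    and C: "finite C" "C \<subseteq> X - A"
  shows "\<exists>h\<in>cyc_Aut X R. (\<forall>a\<in>A. h a = g a) \<and> (\<forall>c\<in>C. h c \<notin> B)"
  using C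
proof (induction C rule: finite_induct)
  case empty
  then show ?case
    using g by blast
next
  case (insert x C)
  then obtain h where h: "h \<in> cyc_Aut X R" "\<forall>a\<in>A. h a = g a" "\<forall>c\<in>C. h c \<notin> B"
    by auto
  have x: "x \<in> X" "x \<notin> A \<union> C" and AC: "finite (A \<union> C)" "A \<union> C \<subseteq> X"
    using insert A by auto
  let ?O = "{k x | k. k \<in> cyc_Aut X R \<and> (\<forall>a\<in>A \<union> C. k a = a)}"
  have OX: "?O \<subseteq> X"
  proof clarify
    fix k assume "k \<in> cyc_Aut X R"
    then show "k x \<in> X"
      using x(1) by (rule cyc_AutD(1))
  qed
  have "infinite (h ` ?O)"
    using infinite_orbit_of_stabilizer[OF AC x]
      finite_imageD[OF _ inj_on_subset[OF cyc_AutD(2)[OF h(1)] OX]] by blast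
  then have "\<not> h ` ?O \<subseteq> B"
    using finite_subset[OF _ B] by blast
  then obtain k where k: "k \<in> cyc_Aut X R" "\<forall>a\<in>A \<union> C. k a = a" "h (k x) \<notin> B"
    by auto
  show ?case
  proof (intro bexI[of _ "compose X h k"] conjI ballI)
    show "compose X h k a = g a" if "a \<in> A" for a
      using that A(2) h(2) k(2) by (auto simp: compose_eq)
    show "compose X h k c \<notin> B" if c: "c \<in> insert x C" for c
    proof (cases "c = x")
      case True
      then show ?thesis
        using x(1) k(3) by (simp add: compose_eq)
    next
      case False
      then have "c \<in> C" "c \<in> X"
        using c AC(2) by auto
      then show ?thesis
        using h(3) k(2) by (simp add: compose_eq)
    qed
  qed (rule compose_in_cyc_Aut[OF h(1) k(1)])
qed

end

section \<open>The closure of the automorphism group\<close>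

lemma in_bG_iff:
  "S \<in> bG X R \<longleftrightarrow> S \<subseteq> X \<times> X \<and>
    (\<forall>F K. finite F \<and> finite K \<and> F \<subseteq> S \<and> S \<inter> K = {} \<longrightarrow>
      (\<exists>g\<in>cyc_Aut X R. F \<subseteq> graph_on X g \<and> graph_on X g \<inter> K = {}))"
proof -
  have "graph_on X ` cyc_Aut X R \<subseteq> Pow (X \<times> X)"
    by (auto simp: graph_on_def dest: cyc_AutD(1))
  then show ?thesis
    unfolding bG_def topspace_permutation_topology
    by (simp add: in_closure_of_fell_discrete)
qed

text \<open>Any three pairs of a limit of graphs lie together in the graph of one automorphism, which has all
  the required properties.\<close>

lemma bG_subset_pAut_graphs: "bG X R \<subseteq> pAut_graphs X R"
proof
  fix S assume S: "S \<in> bG X R"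
  then have sub: "S \<subseteq> X \<times> X"
    by (simp add: in_bG_iff)
  have approx: "\<exists>g\<in>cyc_Aut X R. F \<subseteq> graph_on X g" if "finite F" "F \<subseteq> S" for F
    using S that unfolding in_bG_iff by blast
  show "S \<in> pAut_graphs X R"
  proof (rule pAut_graphsI[OF sub])
    show "b = c" if "(a, b) \<in> S" "(a, c) \<in> S" for a b c
      using approx[of "{(a, b), (a, c)}"] that by (auto simp: graph_on_def)
    show "b = c" if mem: "(b, a) \<in> S" "(c, a) \<in> S" for a b c
    proof -
      obtain g where g: "g \<in> cyc_Aut X R" "g b = a" "g c = a"
        using approx[of "{(b, a), (c, a)}"] mem by (auto simp: graph_on_def)
      moreover have "b \<in> X" "c \<in> X"
        using mem sub by auto
      ultimately show ?thesis
        using inj_onD[OF cyc_AutD(2)[OF g(1)], of b c] by simp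
    qed
    show "R a b c \<longleftrightarrow> R a' b' c'" if mem: "(a, a') \<in> S" "(b, b') \<in> S" "(c, c') \<in> S"
      for a a' b b' c c'
    proof -
      obtain g where g: "g \<in> cyc_Aut X R" "g a = a'" "g b = b'" "g c = c'"
        using approx[of "{(a, a'), (b, b'), (c, c')}"] mem by (auto simp: graph_on_def)
      moreover have "a \<in> X" "b \<in> X" "c \<in> X"
        using mem sub by auto
      ultimately show ?thesis
        using cyc_AutD(3)[OF g(1), of a b c] by simp
    qed
  qed
qed

text \<open>Given \<open>F\<close> and \<open>K\<close>, the first coordinates that occur split into the set \<open>A\<close> of points in the domain of \<open>S\<close>,
  where the automorphism is made to agree with \<open>S\<close>, and the set \<open>C\<close> of the other points of \<open>X\<close>, where it
  suffices to avoid the second coordinates of \<open>K\<close>.\<close>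

lemma (in ultrahomogeneous_cyclic_order) pAut_graphs_subset_bG: "pAut_graphs X R \<subseteq> bG X R"
proof
  fix S assume S: "S \<in> pAut_graphs X R"
  have "\<exists>g\<in>cyc_Aut X R. F \<subseteq> graph_on X g \<and> graph_on X g \<inter> K = {}"
    if FK: "finite F" "finite K" "F \<subseteq> S" "S \<inter> K = {}" for F K
  proof -
    define A where "A = fst ` F \<union> (fst ` K \<inter> Domain S)"
    define C where "C = (fst ` K \<inter> X) - A"
    define p where "p x = (THE y. (x, y) \<in> S)" for x
    have p: "(x, y) \<in> S \<Longrightarrow> p x = y" for x y
      unfolding p_def using pAut_graphsD(2)[OF S] by blast
    have AS: "A \<subseteq> Domain S"
      using FK(3) by (force simp: A_def)
    have pS: "(x, p x) \<in> S" if "x \<in> A" for x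
      using that AS p by auto
    have A: "finite A" "A \<subseteq> X" and C: "finite C" "C \<subseteq> X - A"
      using FK AS pAut_graphsD(1)[OF S] by (auto simp: A_def C_def)
    have "\<exists>g\<in>cyc_Aut X R. \<forall>a\<in>A. g a = p a"
    proof (rule finite_extends_to_aut[OF A])
      show "inj_on p A"
        using pS pAut_graphsD(3)[OF S] by (metis inj_onI)
      show "p ` A \<subseteq> X"
        using pS pAut_graphsD(1)[OF S] by blast
      show "R (p a) (p b) (p c)" if "a \<in> A" "b \<in> A" "c \<in> A" "R a b c" for a b c
        using pAut_graphsD(4)[OF S pS pS pS] that by blast
    qed
    then obtain g where g: "g \<in> cyc_Aut X R" "\<forall>a\<in>A. g a = p a"
      by blast
    obtain h where h: "h \<in> cyc_Aut X R" "\<forall>a\<in>A. h a = p a" "\<forall>c\<in>C. h c \<notin> snd ` K"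
      using aut_agreeing_and_avoiding[OF g(1) A finite_imageI[OF FK(2), of snd] C] g(2) by auto
    have "F \<subseteq> graph_on X h"
    proof
      fix e assume e: "e \<in> F"
      then obtain x y where xy: "e = (x, y)" "x \<in> A" "(x, y) \<in> S"
        using FK(3) by (cases e) (force simp: A_def)
      then show "e \<in> graph_on X h"
        using h(2) p A(2) by (auto simp: graph_on_def)
    qed
    moreover have "(x, h x) \<notin> K" if x: "x \<in> X" for x
    proof
      assume K: "(x, h x) \<in> K"
      then have "x \<in> fst ` K" "h x \<in> snd ` K"
        by force+
      then have "x \<in> A"
        using h(3) x by (auto simp: C_def)
      then show False
        using h(2) pS K FK(4) by (metis disjoint_iff)
    qed
    ultimately show ?thesis
      using h(1) by (auto simp: graph_on_def)
  qed
  then show "S \<in> bG X R"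
    using pAut_graphsD(1)[OF S] by (simp add: in_bG_iff)
qed

lemma (in ultrahomogeneous_cyclic_order) bG_eq_pAut_graphs: "bG X R = pAut_graphs X R"
  using bG_subset_pAut_graphs pAut_graphs_subset_bG by (rule equalityI)

theorem proposition3:
  fixes X :: "'a set" and R :: "'a \<Rightarrow> 'a \<Rightarrow> 'a \<Rightarrow> bool"
  assumes "cyclically_ordered X R" and "infinite X" and "ultrahomogeneous X R"
  shows "Map.graph \<in> iso (pAut_semigroup X R) (bG_semigroup X R) \<and>
    semitopological_semigroup (bG_topology X R) rel_mult \<and>
    continuous_involution (bG_topology X R) rel_mult (\<lambda>A. A\<inverse>)"
proof -
  interpret ultrahomogeneous_cyclic_order X R
    using assms by unfold_locales
  have bG_top: "bG_topology X R = pAut_topology X R"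
    by (simp add: bG_topology_def bG_eq_pAut_graphs)
  have bij: "bij_betw Map.graph (cyc_pAut X R) (pAut_graphs X R)"
    using graph_image_cyc_pAut inj_graph by (auto simp: bij_betw_def intro: inj_on_subset)
  have "Map.graph \<in> iso (pAut_semigroup X R) (bG_semigroup X R)"
    using bij bij_betwE[OF bij]
    by (simp add: iso_def hom_def pAut_semigroup_def bG_semigroup_def bG_eq_pAut_graphs
        rel_mult_def)
  moreover have "semitopological_semigroup (bG_topology X R) rel_mult"
    unfolding semitopological_semigroup_def bG_top topspace_pAut_topology
    using rel_mult_in_pAut_graphs continuous_rel_mult_left continuous_rel_mult_right
    by (auto simp: rel_mult_def O_assoc)
  moreover have "continuous_involution (bG_topology X R) rel_mult (\<lambda>A. A\<inverse>)"
    using continuous_converse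
    by (simp add: continuous_involution_def bG_top rel_mult_def converse_relcomp)
  ultimately show ?thesis
    by blast
qed

end
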